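(* Let $T\in\mathcal{B}_A(\mathcal{H})$. Then $$2w_{\mathbb{A}}\left(\begin{bmatrix}I&T\\O&-I\end{bmatrix}\right)=\left\|\begin{bmatrix}I&T\\O&-I\end{bmatrix}\right\|_{\mathbb{A}}+\left\|\begin{bmatrix}I&T\\O&-I\end{bmatrix}\right\|_{\mathbb{A}}^{-1}.$$
   Context: $\mathcal{H}$ is a complex Hilbert space with inner product $\langle\cdot,\cdot\rangle$, $\mathcal{B}(\mathcal{H})$ is the algebra of bounded linear operators on $\mathcal{H}$, and $A\in\mathcal{B}(\mathcal{H})$ is a nonzero positive operator, i.e. $A$ is selfadjoint and $\langle Ax,x\rangle\ge 0$ for all $x$. Put $\langle x,y\rangle_A=\langle Ax,y\rangle$ and $\|x\|_A=\sqrt{\langle x,x\rangle_A}$. $\mathcal{R}(\cdot)$ denotes range, and $\mathcal{B}_A(\mathcal{H})=\{T\in\mathcal{B}(\mathcal{H}):\mathcal{R}(T^*A)\subseteq\mathcal{R}(A)\}$ (the operators admitting an $A$-adjoint, i.e. some $X\in\mathcal{B}(\mathcal{H})$ with $AX=T^*A$). For $T\in\mathcal{B}_A(\mathcal{H})$: the $A$-operator seminorm is $\|T\|_A=\sup\{\|Tx\|_A/\|x\|_A: x\in\overline{\mathcal{R}(A)},\ x\ne 0\}$, and the $A$-numerical radius is $w_A(T)=\sup\{|\langle Tx,x\rangle_A|:x\in\mathcal{H},\ \|x\|_A=1\}$. $\mathbb{A}=\mathrm{diag}(A,A)$ is the positive operator on $\mathcal{H}\oplus\mathcal{H}$ with diagonal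 entries $A$, and $\|\cdot\|_{\mathbb{A}}$, $w_{\mathbb{A}}$ are defined in the same way with $\mathcal{H}\oplus\mathcal{H}$ and $\mathbb{A}$ in place of $\mathcal{H}$ and $A$. $I$ and $O$ are the identity and null operators on $\mathcal{H}$. *)

theory Defs
  imports "HOL-Analysis.Analysis"
begin

text \<open>
  A complex inner product space is presented as a real inner product space carrying in addition a
  complex scalar multiplication that extends the real one, and a complex inner product
  (linear in the first argument) whose real part is the given real inner product.
  Positive definiteness of \<^term>\<open>inner\<close> yields that of the complex inner product, and norm and
  topology are those induced by it.
\<close>

class complex_inner = real_inner +
  fixes scaleC :: "complex \<Rightarrow> 'a \<Rightarrow> 'a" (infixr \<open>*\<^sub>C\<close> 75)
    and cinner :: "'a \<Rightarrow> 'a \<Rightarrow> complex"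
  assumes scaleC_add_right: "c *\<^sub>C (x + y) = c *\<^sub>C x + c *\<^sub>C y"
    and scaleC_add_left: "(c + d) *\<^sub>C x = c *\<^sub>C x + d *\<^sub>C x"
    and scaleC_scaleC: "c *\<^sub>C (d *\<^sub>C x) = (c * d) *\<^sub>C x"
    and scaleC_of_real: "complex_of_real r *\<^sub>C x = r *\<^sub>R x"
    and cinner_add_left: "cinner (x + y) z = cinner x z + cinner y z"
    and cinner_scaleC_left: "cinner (c *\<^sub>C x) y = c * cinner x y"
    and cinner_commute: "cinner x y = cnj (cinner y x)"
    and Re_cinner: "Re (cinner x y) = inner x y"

class complex_hilbert = complex_inner + complete_space

text \<open>The Hilbert space direct sum is the product type.\<close>

instantiation prod :: (complex_inner, complex_inner) complex_inner
begin

definition scaleC_prod_def: "c *\<^sub>C p = (c *\<^sub>C fst p, c *\<^sub>C snd p)"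

definition cinner_prod_def: "cinner p q = cinner (fst p) (fst q) + cinner (snd p) (snd q)"

instance
proof
  fix p q z :: "'a \<times> 'b" and c d :: complex and r :: real
  show "c *\<^sub>C (p + q) = c *\<^sub>C p + c *\<^sub>C q"
    by (simp add: scaleC_prod_def scaleC_add_right)
  show "(c + d) *\<^sub>C p = c *\<^sub>C p + d *\<^sub>C p"
    by (simp add: scaleC_prod_def scaleC_add_left)
  show "c *\<^sub>C (d *\<^sub>C p) = (c * d) *\<^sub>C p"
    by (simp add: scaleC_prod_def scaleC_scaleC)
  show "complex_of_real r *\<^sub>C p = r *\<^sub>R p"
    by (simp add: scaleC_prod_def scaleC_of_real scaleR_prod_def)
  show "cinner (p + q) z = cinner p z + cinner q z"
    by (simp add: cinner_prod_def cinner_add_left)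
  show "cinner (c *\<^sub>C p) q = c * cinner p q"
    by (simp add: cinner_prod_def scaleC_prod_def cinner_scaleC_left distrib_left)
  show "cinner p q = cnj (cinner q p)"
    unfolding cinner_prod_def complex_cnj_add
    using cinner_commute[of "fst p" "fst q"] cinner_commute[of "snd p" "snd q"] by simp
  show "Re (cinner p q) = inner p q"
    by (simp add: cinner_prod_def inner_prod_def Re_cinner)
qed

end

instance prod :: (complex_hilbert, complex_hilbert) complex_hilbert ..

definition bounded_clinear :: "('a::complex_inner \<Rightarrow> 'b::complex_inner) \<Rightarrow> bool" where
  "bounded_clinear T \<longleftrightarrow> bounded_linear T \<and> (\<forall>c x. T (c *\<^sub>C x) = c *\<^sub>C T x)"

text \<open>
  For bounded complex-linear \<open>T\<close> on a Hilbert space the described operator exists by the Riesz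
  representation theorem; the description is used only for such \<open>T\<close>.
\<close>

definition cadjoint :: "('a::complex_hilbert \<Rightarrow> 'a) \<Rightarrow> 'a \<Rightarrow> 'a" where
  "cadjoint T = (THE S. \<forall>x y. cinner (T x) y = cinner x (S y))"

definition positive_op :: "('a::complex_hilbert \<Rightarrow> 'a) \<Rightarrow> bool" where
  "positive_op A \<longleftrightarrow>
     bounded_clinear A \<and> cadjoint A = A \<and> (\<forall>x. cinner (A x) x \<in> \<real>\<^sub>\<ge>\<^sub>0)"

definition semi_inner :: "('a::complex_hilbert \<Rightarrow> 'a) \<Rightarrow> 'a \<Rightarrow> 'a \<Rightarrow> complex" where
  "semi_inner A x y = cinner (A x) y"

text \<open>For positive \<open>A\<close> the value \<^term>\<open>semi_inner A x x\<close> is real, so \<^term>\<open>Re\<close> is only a coercion.\<close>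

definition semi_norm :: "('a::complex_hilbert \<Rightarrow> 'a) \<Rightarrow> 'a \<Rightarrow> real" where
  "semi_norm A x = sqrt (Re (semi_inner A x x))"

definition adjointable_ops :: "('a::complex_hilbert \<Rightarrow> 'a) \<Rightarrow> ('a \<Rightarrow> 'a) set" where
  "adjointable_ops A = {T. bounded_clinear T \<and> range (cadjoint T \<circ> A) \<subseteq> range A}"

text \<open>
  The suprema are taken in the reals. For positive \<open>A \<noteq> 0\<close> and \<open>T \<in> adjointable_ops A\<close> both index
  sets are nonempty and both families are bounded above, and \<^term>\<open>semi_norm A x\<close> is nonzero for
  nonzero \<open>x\<close> in the closure of the range of \<open>A\<close>.
\<close>

definition op_seminorm :: "('a::complex_hilbert \<Rightarrow> 'a) \<Rightarrow> ('a \<Rightarrow> 'a) \<Rightarrow> real" where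
  "op_seminorm A T =
     (SUP x\<in>{x \<in> closure (range A). x \<noteq> 0}. semi_norm A (T x) / semi_norm A x)"

definition num_radius :: "('a::complex_hilbert \<Rightarrow> 'a) \<Rightarrow> ('a \<Rightarrow> 'a) \<Rightarrow> real" where
  "num_radius A T = (SUP x\<in>{x. semi_norm A x = 1}. cmod (semi_inner A (T x) x))"

text \<open>\<open>block_op P Q R S\<close> is the operator matrix with rows \<open>P, Q\<close> and \<open>R, S\<close>.\<close>

definition block_op ::
  "('a::complex_hilbert \<Rightarrow> 'a) \<Rightarrow> ('a \<Rightarrow> 'a) \<Rightarrow> ('a \<Rightarrow> 'a) \<Rightarrow> ('a \<Rightarrow> 'a) \<Rightarrow> 'a \<times> 'a \<Rightarrow> 'a \<times> 'a" where
  "block_op P Q R S = (\<lambda>(x, y). (P x + Q y, R x + S y))"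

definition diag_op :: "('a::complex_hilbert \<Rightarrow> 'a) \<Rightarrow> 'a \<times> 'a \<Rightarrow> 'a \<times> 'a" where
  "diag_op A = block_op A (\<lambda>_. 0) (\<lambda>_. 0) A"

end

theory Submission
  imports Defs
begin

text \<open>
  Write \<open>M\<close> for the block operator, \<open>n\<close> for its seminorm, \<open>w\<close> for its numerical radius and \<open>t\<close> for
  the seminorm of \<open>T\<close>. If \<open>T\<close> is multiplication by the number \<open>t\<close>, then \<open>M\<close> is a \<open>2 \<times> 2\<close> matrix of
  determinant \<open>-1\<close> and Hilbert-Schmidt norm \<open>sqrt (t\<^sup>2 + 2)\<close>. Its singular values are therefore \<open>n\<close>
  and \<open>1 / n\<close> with \<open>n - 1 / n = t\<close>, and its numerical range is an ellipse with foci \<open>1\<close> and \<open>-1\<close>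
  and minor axis \<open>t\<close>, so that \<open>2 * w = sqrt (t\<^sup>2 + 4)\<close>. Since \<open>(n + 1 / n)\<^sup>2 = (n - 1 / n)\<^sup>2 + 4\<close>, this
  is the claim.

  Both formulas remain true for every \<open>T\<close> (\<open>op_seminorm_block\<close>, \<open>num_radius_block\<close>). For the upper
  bounds, only the seminorms of the components \<open>x\<close> and \<open>y\<close> and the number \<open>t\<close> enter, which is the
  scalar case. For the lower bounds, the vectors \<open>(l *\<^sub>R T y, y)\<close> with \<open>l\<close> real reproduce the
  scalar case with \<open>t\<close> replaced by the quotient of the seminorms of \<open>T y\<close> and \<open>y\<close>.

  This presupposes that \<open>T\<close> is bounded for the seminorm of \<open>A\<close> (\<open>adjointable_bounded\<close>). Let \<open>T'\<close> be
  the Hilbert space adjoint of \<open>T\<close>, which exists by the Riesz representation theorem, and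
  \<open>B = T' A T\<close>, a symmetric operator whose range lies in that of \<open>A\<close>. By the uniform boundedness
  principle \<open>norm (B x) \<le> c * norm (A x)\<close>, that is \<open>B\<^sup>2 \<le> c\<^sup>2 A\<^sup>2\<close>. Monotonicity of the operator
  square root then gives \<open>B \<le> c A\<close>, which says that the squared seminorm of \<open>T x\<close> is at most \<open>c\<close>
  times that of \<open>x\<close>. The seminorm of an operator is a supremum over the closure of the range of \<open>A\<close>
  only, but it bounds the operator on all vectors: the orthogonal complement of that closure is the
  kernel of \<open>A\<close>, which a bounded operator maps to vectors of seminorm zero.
\<close>

section \<open>Riesz representation and uniform boundedness\<close>

lemma nonneg_parabola_at_zero:
  fixes d q :: real
  assumes "\<And>s. 0 \<le> 2 * s * d + s\<^sup>2 * q" "0 \<le> q"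
  shows "d = 0"
proof (rule ccontr)
  assume d: "d \<noteq> 0"
  have "2 * (- d / (q + 1)) * d + (- d / (q + 1))\<^sup>2 * q = - (d\<^sup>2 * (q + 2) / (q + 1)\<^sup>2)"
    using assms(2) by (simp add: divide_simps power2_eq_square) algebra
  moreover have "0 < d\<^sup>2 * (q + 2) / (q + 1)\<^sup>2"
    using d assms(2) by simp
  ultimately show False using assms(1)[of "- d / (q + 1)"] by linarith
qed

text \<open>
  The representing vector minimises \<open>(norm u)\<^sup>2 - 2 * \<phi> u\<close> over \<open>V\<close>; by the parallelogram law every
  minimising sequence is Cauchy. For \<open>V = UNIV\<close> this is the Riesz representation theorem. For
  \<open>\<phi> = inner x\<close> it yields the orthogonal projection of \<open>x\<close> to \<open>V\<close>.
\<close>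

lemma riesz_on_closed_subspace:
  fixes V :: "'a::{real_inner,complete_space} set" and \<phi> :: "'a \<Rightarrow> real"
  assumes V: "subspace V" "closed V" and \<phi>: "bounded_linear \<phi>"
  obtains v where "v \<in> V" "\<And>u. u \<in> V \<Longrightarrow> \<phi> u = inner v u"
proof -
  interpret \<phi>: bounded_linear \<phi> by (rule \<phi>)
  define J where "J u = (norm u)\<^sup>2 - 2 * \<phi> u" for u
  define m where "m = Inf (J ` V)"
  obtain K where K: "\<And>u. norm (\<phi> u) \<le> norm u * K" using \<phi>.bounded by blast
  have "- K\<^sup>2 \<le> J u" for u
  proof -
    have "\<phi> u \<le> norm u * K" using K[of u] by simp
    moreover have "0 \<le> (norm u - K)\<^sup>2" by simp
    ultimately show ?thesis by (simp add: J_def power2_diff)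
  qed
  hence bdd: "bdd_below (J ` V)" by (auto simp: bdd_below_def)
  have ne: "V \<noteq> {}" using V(1) subspace_0 by blast
  have m_le: "m \<le> J u" if "u \<in> V" for u
    unfolding m_def using that by (auto intro: cInf_lower bdd)
  have par: "(norm (u - v))\<^sup>2 \<le> 2 * ((J u - m) + (J v - m))" if "u \<in> V" "v \<in> V" for u v
  proof -
    define c where "c = (1/2) *\<^sub>R (u + v)"
    have "m \<le> J c"
      unfolding c_def using that V(1) by (intro m_le) (auto intro: subspace_scale subspace_add)
    moreover have "4 * J c = 2 * (J u + J v) - (norm (u - v))\<^sup>2"
      by (simp add: c_def J_def \<phi>.scaleR \<phi>.add power_mult_distrib power2_norm_eq_inner
          inner_add_left inner_add_right inner_diff_left inner_diff_right inner_commute field_simps)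
    ultimately show ?thesis by (simp add: algebra_simps)
  qed
  have "\<exists>u\<in>V. J u < m + 1 / real (Suc n)" for n
  proof -
    have "\<exists>y\<in>J ` V. y < m + 1 / real (Suc n)"
      unfolding m_def using ne by (intro cInf_lessD) auto
    thus ?thesis by blast
  qed
  then obtain u where uV: "\<And>n. u n \<in> V" and uJ: "\<And>n. J (u n) < m + 1 / real (Suc n)" by metis
  have "Cauchy u"
  proof (rule metric_CauchyI)
    fix e :: real assume e: "0 < e"
    obtain N where N: "4 / e\<^sup>2 < real N" using reals_Archimedean2 by blast
    have N': "4 / real (Suc N) < e\<^sup>2"
    proof -
      have "4 < real N * e\<^sup>2" using N e by (simp add: divide_simps split: if_splits)
      also have "\<dots> \<le> real (Suc N) * e\<^sup>2" by (intro mult_right_mono) auto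
      finally show ?thesis by (simp add: divide_simps mult.commute del: of_nat_Suc)
    qed
    have "dist (u i) (u j) < e" if "i \<ge> N" "j \<ge> N" for i j
    proof -
      have le: "1 / real (Suc k) \<le> 1 / real (Suc N)" if "k \<ge> N" for k
        using that by (simp add: frac_le)
      have "(norm (u i - u j))\<^sup>2 \<le> 2 * ((J (u i) - m) + (J (u j) - m))" by (rule par[OF uV uV])
      also have "\<dots> \<le> 2 * (1 / real (Suc i) + 1 / real (Suc j))"
        using uJ[of i] uJ[of j] by simp
      also have "\<dots> \<le> 4 / real (Suc N)" using le[OF that(1)] le[OF that(2)] by simp
      finally have "(norm (u i - u j))\<^sup>2 < e\<^sup>2" using N' by linarith
      thus ?thesis using e by (simp add: dist_norm power_less_imp_less_base)
    qed
    thus "\<exists>N. \<forall>i\<ge>N. \<forall>j\<ge>N. dist (u i) (u j) < e" by blast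
  qed
  then obtain v where lim: "u \<longlonglongrightarrow> v" using Cauchy_convergent convergent_def by blast
  have vV: "v \<in> V" using V(2) uV lim closed_sequentially by blast
  have "(\<lambda>n. J (u n)) \<longlonglongrightarrow> J v"
    unfolding J_def by (intro tendsto_intros lim \<phi>.tendsto)
  moreover have "(\<lambda>n. m + 1 / real (Suc n)) \<longlonglongrightarrow> m + 0"
    by (intro tendsto_intros LIMSEQ_Suc lim_1_over_n)
  ultimately have "J v \<le> m + 0"
    by (rule LIMSEQ_le) (use uJ less_imp_le in blast)
  have "\<phi> w = inner v w" if w: "w \<in> V" for w
  proof -
    have "0 \<le> 2 * s * (inner v w - \<phi> w) + s\<^sup>2 * (norm w)\<^sup>2" for s
    proof -
      have "J v \<le> J (v + s *\<^sub>R w)"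
        using \<open>J v \<le> m + 0\<close> m_le[of "v + s *\<^sub>R w"] vV w V(1)
        by (force intro: subspace_scale subspace_add)
      moreover have "J (v + s *\<^sub>R w) = J v + (2 * s * (inner v w - \<phi> w) + s\<^sup>2 * (norm w)\<^sup>2)"
        by (simp add: J_def \<phi>.scaleR \<phi>.add power2_norm_eq_inner inner_add_left inner_add_right
            inner_commute[of w v]) (simp add: algebra_simps power2_eq_square)
      ultimately show ?thesis by linarith
    qed
    from nonneg_parabola_at_zero[OF this] show ?thesis by simp
  qed
  with vV that show ?thesis by blast
qed

text \<open>
  The usual Baire argument: the closed sets on which the whole family is bounded by an integer cover
  the space, so one of them contains a ball.
\<close>

lemma banach_steinhaus_functionals:
  fixes F :: "('a::{real_normed_vector,complete_space} \<Rightarrow> real) set"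
  assumes lin: "\<And>f. f \<in> F \<Longrightarrow> bounded_linear f"
    and pw: "\<And>z. \<exists>K. \<forall>f\<in>F. \<bar>f z\<bar> \<le> K"
  obtains C where "0 \<le> C" "\<And>f z. f \<in> F \<Longrightarrow> \<bar>f z\<bar> \<le> C * norm z"
proof -
  define S where "S n = {z. \<forall>f\<in>F. \<bar>f z\<bar> \<le> real n}" for n
  have cl: "closed (S n)" for n
  proof -
    have "S n = (\<Inter>f\<in>F. {z. \<bar>f z\<bar> \<le> real n})" by (auto simp: S_def)
    moreover have "closed {z. \<bar>f z\<bar> \<le> real n}" if "f \<in> F" for f
      by (intro closed_Collect_le continuous_intros
          bounded_linear.continuous_on[OF lin[OF that]])
    ultimately show ?thesis by auto
  qed
  have cover: "\<Union>(range S) = UNIV"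
  proof -
    have "\<exists>n. z \<in> S n" for z
    proof -
      obtain K where K: "\<forall>f\<in>F. \<bar>f z\<bar> \<le> K" using pw by blast
      obtain n where "K \<le> real n" using real_arch_simple by blast
      with K show ?thesis unfolding S_def by (blast intro: order_trans)
    qed
    thus ?thesis by blast
  qed
  have "\<exists>n. interior (S n) \<noteq> {}"
  proof (rule ccontr)
    assume "\<not> ?thesis"
    hence "interior (\<Union>(range S)) = {}"
      using Met_TC.metric_Baire_category_alt[of "range S"] cl complete_UNIV by auto
    thus False unfolding cover by simp
  qed
  then obtain n a where "a \<in> interior (S n)" by blast
  then obtain e where e: "0 < e" "cball a e \<subseteq> S n"
    by (meson interior_subset open_contains_cball open_interior subset_trans)
  have "\<bar>f z\<bar> \<le> (2 * real n / e) * norm z" if f: "f \<in> F" for f z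
  proof (cases "z = 0")
    case True
    then show ?thesis using bounded_linear.linear[OF lin[OF f]] by (simp add: linear_0)
  next
    case False
    interpret f: bounded_linear f by (rule lin[OF f])
    define y where "y = (e / norm z) *\<^sub>R z"
    have "norm y = e" using False e by (simp add: y_def)
    hence "a + y \<in> S n" "a \<in> S n" using e by (auto simp: subset_iff dist_norm)
    hence "\<bar>f (a + y)\<bar> \<le> real n" "\<bar>f a\<bar> \<le> real n" using f by (auto simp: S_def)
    hence "\<bar>f y\<bar> \<le> 2 * real n" by (simp add: f.add)
    hence "e / norm z * \<bar>f z\<bar> \<le> 2 * real n" using e by (simp add: y_def f.scaleR abs_mult)
    thus ?thesis using False e by (simp add: field_simps)
  qed
  moreover have "0 \<le> 2 * real n / e" using e by simp
  ultimately show ?thesis using that by blast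
qed

section \<open>Comparison of symmetric operators\<close>

lemma symmetric_imp_linear:
  fixes B :: "'a::real_inner \<Rightarrow> 'a"
  assumes sym: "\<And>x y. inner (B x) y = inner x (B y)"
  shows "linear B"
proof (rule linearI)
  have ext: "u = v" if "\<And>z. inner u z = inner v z" for u v :: 'a
  proof -
    have "inner (u - v) (u - v) = 0" using that[of "u - v"] by (simp add: inner_diff_left)
    thus ?thesis by simp
  qed
  show "B (x + y) = B x + B y" for x y
    by (rule ext) (simp add: sym inner_add_left)
  show "B (r *\<^sub>R x) = r *\<^sub>R B x" for r x
    by (rule ext) (simp add: sym)
qed

lemma positive_cauchy_schwarz:
  fixes E :: "'a::real_inner \<Rightarrow> 'a"
  assumes sym: "\<And>x y. inner (E x) y = inner x (E y)"
    and pos: "\<And>x. 0 \<le> inner (E x) x"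
  shows "(inner (E x) y)\<^sup>2 \<le> inner (E x) x * inner (E y) y"
proof -
  interpret E: linear E by (rule symmetric_imp_linear[OF sym])
  have sw: "inner (E y) x = inner (E x) y"
    using sym[of x y] by (simp add: inner_commute)
  have par: "0 \<le> inner (E x) x + 2 * s * inner (E x) y + s\<^sup>2 * inner (E y) y" for s
    using pos[of "x + s *\<^sub>R y"] sw
    by (simp add: E.add E.scaleR inner_add_left inner_add_right power2_eq_square algebra_simps)
  show ?thesis
  proof (cases "inner (E y) y = 0")
    case True
    have "inner (E x) y = 0"
    proof (rule ccontr)
      assume "inner (E x) y \<noteq> 0"
      with par[of "- (inner (E x) x + 1) / (2 * inner (E x) y)"] True show False by (simp add: divide_simps)
    qed
    thus ?thesis using True by simp
  next
    case False
    hence q: "0 < inner (E y) y" using pos[of y] by simp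
    have "0 \<le> inner (E x) x - (inner (E x) y)\<^sup>2 / inner (E y) y"
      using par[of "- inner (E x) y / inner (E y) y"] q
      by (simp add: power2_eq_square divide_simps split: if_splits)
    thus ?thesis using q by (simp add: field_simps)
  qed
qed

text \<open>
  The symmetric case of Douglas' lemma. If \<open>B z = A u\<close>, then \<open>inner (B x) z = inner (A x) u\<close> for
  every \<open>x\<close>, so the functionals \<open>inner (B x) / norm (A x)\<close> are pointwise bounded.
\<close>

lemma range_inclusion_imp_norm_bound:
  fixes A B :: "'a::{real_inner,complete_space} \<Rightarrow> 'a"
  assumes symA: "\<And>x y. inner (A x) y = inner x (A y)"
    and symB: "\<And>x y. inner (B x) y = inner x (B y)"
    and range: "range B \<subseteq> range A"
  obtains c where "0 \<le> c" "\<And>x. norm (B x) \<le> c * norm (A x)"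
proof -
  have via_A: "\<exists>u. \<forall>x. inner (B x) z = inner (A x) u" for z
  proof -
    obtain u where "B z = A u" using range by blast
    thus ?thesis using symA symB by metis
  qed
  \<comment> \<open>If \<open>A x = 0\<close>, division by zero makes the functional zero.\<close>
  define F where "F = range (\<lambda>x z. inner (B x) z / norm (A x))"
  have lin: "bounded_linear f" if "f \<in> F" for f
    using that unfolding F_def
    by (auto intro: bounded_linear_inner_right bounded_linear_compose[OF bounded_linear_divide])
  have pw: "\<exists>K. \<forall>f\<in>F. \<bar>f z\<bar> \<le> K" for z
  proof -
    obtain u where u: "\<forall>x. inner (B x) z = inner (A x) u" using via_A by blast
    have "\<bar>inner (B x) z / norm (A x)\<bar> \<le> norm u" for x
      using Cauchy_Schwarz_ineq2[of "A x" u] u by (cases "A x = 0") (auto simp: divide_simps mult.commute)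
    thus ?thesis unfolding F_def by blast
  qed
  obtain C where C: "0 \<le> C" "\<And>f z. f \<in> F \<Longrightarrow> \<bar>f z\<bar> \<le> C * norm z"
    using banach_steinhaus_functionals[OF lin pw] by blast
  have "norm (B x) \<le> C * norm (A x)" for x
  proof (cases "A x = 0")
    case True
    obtain u where "\<forall>x'. inner (B x') (B x) = inner (A x') u" using via_A by blast
    hence "inner (B x) (B x) = 0" using True by simp
    thus ?thesis using True by simp
  next
    case False
    have "(\<lambda>z. inner (B x) z / norm (A x)) \<in> F" unfolding F_def by blast
    from C(2)[OF this, of "B x"] have "norm (B x) * norm (B x) / norm (A x) \<le> C * norm (B x)"
      by (simp add: norm_eq_sqrt_inner)
    hence "norm (B x) * norm (B x) \<le> (C * norm (A x)) * norm (B x)"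
      using False by (simp add: field_simps)
    thus ?thesis
      using C(1) by (cases "B x = 0") auto
  qed
  with C(1) that show ?thesis by blast
qed

text \<open>
  This is the operator monotonicity of the square root, \<open>B\<^sup>2 \<le> (c A)\<^sup>2\<close> implies \<open>B \<le> c A\<close>, proved
  without functional calculus. Let \<open>m\<close> be the infimum of the form of \<open>D = c A - B\<close> on the unit sphere
  and suppose \<open>m < 0\<close>. The operator \<open>E = D - m\<close> is positive, and \<open>B + E = c A - m\<close>. On unit vectors,
  \<open>(norm (c A z - m z))\<^sup>2\<close> exceeds \<open>(norm (c A z))\<^sup>2\<close>, and hence \<open>(norm (B z))\<^sup>2\<close>, by at least \<open>m\<^sup>2\<close>,
  because \<open>A\<close> is positive and \<open>- m > 0\<close>. So \<open>E z\<close> is bounded away from zero in norm, and, \<open>E\<close> being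
  positive and bounded, so is \<open>inner (E z) z\<close>. Then \<open>m\<close> is not the infimum.
\<close>

lemma norm_bound_imp_form_bound:
  fixes A B :: "'a::real_inner \<Rightarrow> 'a"
  assumes A: "bounded_linear A"
    and symA: "\<And>x y. inner (A x) y = inner x (A y)" and posA: "\<And>x. 0 \<le> inner (A x) x"
    and symB: "\<And>x y. inner (B x) y = inner x (B y)"
    and c: "0 \<le> c" and le: "\<And>x. norm (B x) \<le> c * norm (A x)"
  shows "inner (B x) x \<le> c * inner (A x) x"
proof (rule ccontr)
  assume "\<not> ?thesis"
  hence x: "c * inner (A x) x < inner (B x) x" by simp
  interpret A: bounded_linear A by (rule A)
  interpret B: linear B by (rule symmetric_imp_linear[OF symB])
  obtain a where a: "0 < a" "\<And>z. norm (A z) \<le> norm z * a" using A.pos_bounded by blast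
  define K where "K = c * a"
  have K0: "0 \<le> K" using a(1) c by (simp add: K_def)
  have K: "norm (B z) \<le> K * norm z" for z
    using order_trans[OF le mult_left_mono[OF a(2) c]] by (simp add: K_def ac_simps)
  define D where "D z = c *\<^sub>R A z - B z" for z
  have D_le: "norm (D z) \<le> 2 * K * norm z" for z
  proof -
    have "norm (D z) \<le> c * norm (A z) + norm (B z)"
      unfolding D_def using norm_triangle_ineq4[of "c *\<^sub>R A z" "B z"] c by simp
    also have "c * norm (A z) \<le> K * norm z"
      using mult_left_mono[OF a(2) c] by (simp add: K_def ac_simps)
    finally show ?thesis using K[of z] by simp
  qed
  have DscaleR: "inner (D (r *\<^sub>R z)) (r *\<^sub>R z) = r\<^sup>2 * inner (D z) z" for r z
    by (simp add: D_def A.scaleR B.scaleR inner_diff_left power2_eq_square algebra_simps)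
  have Dx: "inner (D x) x < 0" using x by (simp add: D_def inner_diff_left)
  hence x0: "x \<noteq> 0" by auto
  define U where "U = {z::'a. norm z = 1}"
  define m where "m = (INF z\<in>U. inner (D z) z)"
  have bdd: "bdd_below ((\<lambda>z. inner (D z) z) ` U)"
  proof (rule bdd_belowI2)
    fix z assume "z \<in> U"
    hence "norm (D z) \<le> 2 * K" "norm z = 1" using D_le[of z] by (auto simp: U_def)
    thus "- (2 * K) \<le> inner (D z) z" using Cauchy_Schwarz_ineq2[of "D z" z] by simp
  qed
  have xU: "(1 / norm x) *\<^sub>R x \<in> U" using x0 by (simp add: U_def)
  have "m \<le> (1 / norm x)\<^sup>2 * inner (D x) x"
    unfolding m_def DscaleR[symmetric] by (rule cINF_lower[OF bdd xU])
  also have "\<dots> < 0" using Dx x0 by (simp add: mult_pos_neg)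
  finally have m: "m < 0" .
  define E where "E z = D z - m *\<^sub>R z" for z
  have symE: "inner (E y) z = inner y (E z)" for y z
    by (simp add: E_def D_def inner_diff_left inner_diff_right symA symB)
  have posE: "0 \<le> inner (E z) z" for z
  proof (cases "z = 0")
    case False
    have "(1 / norm z) *\<^sub>R z \<in> U" using False by (simp add: U_def)
    hence "m \<le> (1 / norm z)\<^sup>2 * inner (D z) z"
      unfolding m_def DscaleR[symmetric] by (rule cINF_lower[OF bdd])
    hence "m * (norm z)\<^sup>2 \<le> inner (D z) z" using False by (simp add: field_simps)
    thus ?thesis by (simp add: E_def inner_diff_left power2_norm_eq_inner)
  qed simp
  define L where "L = 2 * K - m"
  have L0: "0 < L" using K0 m by (simp add: L_def)
  have E_le: "norm (E z) \<le> L * norm z" for z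
  proof -
    have "norm (E z) \<le> norm (D z) + \<bar>m\<bar> * norm z"
      unfolding E_def using norm_triangle_ineq4[of "D z" "m *\<^sub>R z"] by simp
    also have "\<dots> \<le> 2 * K * norm z + \<bar>m\<bar> * norm z" using D_le[of z] by simp
    finally show ?thesis using m by (simp add: L_def algebra_simps)
  qed
  \<comment> \<open>Cauchy-Schwarz for the form of \<open>E\<close>, applied to \<open>z\<close> and \<open>E z\<close>: a vector almost isotropic for
    this form is almost in the kernel of \<open>E\<close>.\<close>
  have E_form: "(norm (E z))\<^sup>2 \<le> L * inner (E z) z" for z
  proof (cases "E z = 0")
    case False
    have "((norm (E z))\<^sup>2)\<^sup>2 \<le> inner (E z) z * inner (E (E z)) (E z)"
      using positive_cauchy_schwarz[OF symE posE, of z "E z"] by (simp add: power2_norm_eq_inner)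
    also have "\<dots> \<le> inner (E z) z * (L * (norm (E z))\<^sup>2)"
    proof (rule mult_left_mono[OF _ posE])
      have "inner (E (E z)) (E z) \<le> norm (E (E z)) * norm (E z)" by (rule norm_cauchy_schwarz)
      also have "\<dots> \<le> L * norm (E z) * norm (E z)" using E_le by (intro mult_right_mono) auto
      finally show "inner (E (E z)) (E z) \<le> L * (norm (E z))\<^sup>2"
        by (simp add: power2_eq_square)
    qed
    finally have "(norm (E z))\<^sup>2 * (norm (E z))\<^sup>2 \<le> (L * inner (E z) z) * (norm (E z))\<^sup>2"
      by (simp add: power2_eq_square ac_simps)
    moreover have "0 < (norm (E z))\<^sup>2" using False by simp
    ultimately show ?thesis by (rule mult_right_le_imp_le)
  qed (use L0 in simp)
  define P where "P = 2 * K + L"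
  have P0: "0 < P" using K0 L0 by (simp add: P_def)
  define \<delta> where "\<delta> = (m\<^sup>2 / P)\<^sup>2 / L"
  have \<delta>0: "0 < \<delta>" using P0 L0 m by (simp add: \<delta>_def)
  have "m + \<delta> \<le> inner (D z) z" if "z \<in> U" for z
  proof -
    have z1: "norm z = 1" using that by (simp add: U_def)
    have eq: "B z + E z = c *\<^sub>R A z + (- m) *\<^sub>R z" by (simp add: E_def D_def)
    have "c\<^sup>2 * (norm (A z))\<^sup>2 + m\<^sup>2 \<le> (norm (c *\<^sub>R A z + (- m) *\<^sub>R z))\<^sup>2"
    proof -
      have "(norm (c *\<^sub>R A z + (- m) *\<^sub>R z))\<^sup>2
          = c\<^sup>2 * (norm (A z))\<^sup>2 + m\<^sup>2 * (norm z)\<^sup>2 + 2 * (c * (- m) * inner (A z) z)"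
        by (simp only: power2_norm_eq_inner)
          (simp add: inner_diff_left inner_diff_right inner_commute power2_eq_square algebra_simps)
      moreover have "0 \<le> c * (- m) * inner (A z) z"
        using c m posA[of z] by (intro mult_nonneg_nonneg) auto
      ultimately show ?thesis using z1 by simp
    qed
    also have "\<dots> = (norm (B z))\<^sup>2 + 2 * inner (B z) (E z) + (norm (E z))\<^sup>2"
      unfolding eq[symmetric] power2_norm_eq_inner
      by (simp add: inner_add_left inner_add_right inner_commute)
    also have "(norm (B z))\<^sup>2 \<le> c\<^sup>2 * (norm (A z))\<^sup>2"
      using power_mono[OF le norm_ge_zero, of z 2] by (simp add: power_mult_distrib)
    also have "inner (B z) (E z) \<le> K * norm (E z)"
      using K[of z] z1 by (intro order_trans[OF norm_cauchy_schwarz] mult_right_mono) auto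
    also have "(norm (E z))\<^sup>2 \<le> L * norm (E z)"
      using E_le[of z] z1 by (simp add: power2_eq_square mult_right_mono)
    finally have "m\<^sup>2 \<le> P * norm (E z)" by (simp add: P_def algebra_simps)
    hence "m\<^sup>2 / P \<le> norm (E z)" using P0 by (simp add: field_simps)
    hence "(m\<^sup>2 / P)\<^sup>2 \<le> (norm (E z))\<^sup>2" using P0 by (intro power_mono) auto
    also have "\<dots> \<le> L * inner (E z) z" by (rule E_form)
    finally have "\<delta> \<le> inner (E z) z" by (simp only: \<delta>_def pos_divide_le_eq[OF L0] mult.commute)
    moreover have "inner (E z) z = inner (D z) z - m"
      using z1 by (simp add: E_def inner_diff_left flip: power2_norm_eq_inner)
    ultimately show ?thesis by simp
  qed
  hence "m + \<delta> \<le> m" unfolding m_def using xU by (intro cINF_greatest) auto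
  with \<delta>0 show False by simp
qed

section \<open>Adjoints\<close>

lemma Im_cinner: "Im (cinner x y) = - inner (\<i> *\<^sub>C x) y"
  by (simp add: Re_cinner[symmetric] cinner_scaleC_left)

lemma bounded_clinear_adjoint_exists:
  fixes T :: "'a::complex_hilbert \<Rightarrow> 'a"
  assumes T: "bounded_clinear T"
  shows "\<exists>S. \<forall>x y. cinner (T x) y = cinner x (S y)"
proof -
  have T1: "bounded_linear T" and T2: "\<And>c x. T (c *\<^sub>C x) = c *\<^sub>C T x"
    using T by (auto simp: bounded_clinear_def)
  have "\<exists>s. \<forall>x. cinner (T x) y = cinner x s" for y
  proof -
    have "bounded_linear (\<lambda>x. inner (T x) y)"
      by (rule bounded_linear_compose[OF bounded_linear_inner_left T1])
    then obtain s where "\<And>x. inner (T x) y = inner s x"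
      using riesz_on_closed_subspace[of UNIV "\<lambda>x. inner (T x) y"] by (metis UNIV_I closed_UNIV subspace_UNIV)
    hence s: "inner (T x) y = inner x s" for x by (simp add: inner_commute)
    have "cinner (T x) y = cinner x s" for x
      using s[of x] s[of "\<i> *\<^sub>C x"] by (simp add: complex_eq_iff Re_cinner Im_cinner T2)
    thus ?thesis by blast
  qed
  thus ?thesis by metis
qed

lemma cadjoint_eqI:
  assumes "\<And>x y. cinner (T x) y = cinner x (S y)"
  shows "cadjoint T = S"
  unfolding cadjoint_def
proof (rule the_equality)
  show "\<forall>x y. cinner (T x) y = cinner x (S y)" using assms by blast
  fix R assume R: "\<forall>x y. cinner (T x) y = cinner x (R y)"
  have "R y = S y" for y
  proof -
    have "inner x (R y) = inner x (S y)" for x using R assms by (simp flip: Re_cinner)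
    hence "inner (R y - S y) (R y - S y) = 0" by (simp add: inner_diff_right)
    thus ?thesis by simp
  qed
  thus "R = S" by blast
qed

lemma cinner_cadjoint:
  assumes "bounded_clinear T"
  shows "cinner (T x) y = cinner x (cadjoint T y)"
  using bounded_clinear_adjoint_exists[OF assms] cadjoint_eqI by metis

section \<open>The seminorm of a positive operator\<close>

lemma subspace_closure:
  fixes V :: "'a::real_normed_vector set"
  assumes "subspace V"
  shows "subspace (closure V)"
proof (rule subspaceI)
  show "0 \<in> closure V" using assms closure_subset subspace_0 by blast
  show "x + y \<in> closure V" if xy: "x \<in> closure V" "y \<in> closure V" for x y
  proof -
    obtain f where "\<And>n. f n \<in> V" "f \<longlonglongrightarrow> x"
      using xy(1) unfolding closure_sequential by blast
    moreover obtain g where "\<And>n. g n \<in> V" "g \<longlonglongrightarrow> y"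
      using xy(2) unfolding closure_sequential by blast
    ultimately have "\<And>n. f n + g n \<in> V" "(\<lambda>n. f n + g n) \<longlonglongrightarrow> x + y"
      by (auto intro: tendsto_add subspace_add[OF assms])
    thus ?thesis unfolding closure_sequential by (intro exI[of _ "\<lambda>n. f n + g n"]) simp
  qed
  show "r *\<^sub>R x \<in> closure V" if x: "x \<in> closure V" for r x
  proof -
    obtain f where "\<And>n. f n \<in> V" "f \<longlonglongrightarrow> x"
      using x unfolding closure_sequential by blast
    hence "\<And>n. r *\<^sub>R f n \<in> V" "(\<lambda>n. r *\<^sub>R f n) \<longlonglongrightarrow> r *\<^sub>R x"
      by (auto intro: tendsto_intros subspace_scale[OF assms])
    thus ?thesis unfolding closure_sequential by (intro exI[of _ "\<lambda>n. r *\<^sub>R f n"]) simp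
  qed
qed

locale semi_hilbert =
  fixes A :: "'a::complex_hilbert \<Rightarrow> 'a"
  assumes positive: "positive_op A"
begin

abbreviation seminorm_A ("\<parallel>_\<parallel>\<^sub>A") where "\<parallel>x\<parallel>\<^sub>A \<equiv> semi_norm A x"

lemma bounded_linear_A: "bounded_linear A"
  using positive by (auto simp: positive_op_def bounded_clinear_def)

lemma A_scaleC: "A (c *\<^sub>C x) = c *\<^sub>C A x"
  using positive by (auto simp: positive_op_def bounded_clinear_def)

lemma cinner_A_sym: "cinner (A x) y = cinner x (A y)"
  using positive cinner_cadjoint[of A x y] by (simp add: positive_op_def)

lemma inner_A_sym: "inner (A x) y = inner x (A y)"
  by (simp add: Re_cinner[symmetric] cinner_A_sym)

lemma inner_A_nonneg: "0 \<le> inner (A x) x"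
  using positive by (auto simp: positive_op_def Re_cinner[symmetric] complex_nonneg_Reals_iff)

lemma seminorm_squared: "\<parallel>x\<parallel>\<^sub>A\<^sup>2 = inner (A x) x"
  using inner_A_nonneg by (simp add: semi_norm_def semi_inner_def Re_cinner)

lemma seminorm_nonneg: "0 \<le> \<parallel>x\<parallel>\<^sub>A"
  by (simp add: semi_norm_def semi_inner_def Re_cinner inner_A_nonneg)

lemma semi_inner_self: "semi_inner A x x = complex_of_real (\<parallel>x\<parallel>\<^sub>A\<^sup>2)"
proof -
  have "cinner (A x) x \<in> \<real>"
    using positive nonneg_Reals_subset_Reals by (auto simp: positive_op_def)
  thus ?thesis
    by (simp add: seminorm_squared semi_inner_def complex_eq_iff Re_cinner complex_is_Real_iff)
qed

lemma seminorm_cauchy_schwarz: "inner (A x) y \<le> \<parallel>x\<parallel>\<^sub>A * \<parallel>y\<parallel>\<^sub>A"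
proof (rule power2_le_imp_le)
  show "(inner (A x) y)\<^sup>2 \<le> (\<parallel>x\<parallel>\<^sub>A * \<parallel>y\<parallel>\<^sub>A)\<^sup>2"
    using positive_cauchy_schwarz[OF inner_A_sym inner_A_nonneg]
    by (simp add: power_mult_distrib seminorm_squared)
qed (simp add: seminorm_nonneg)

lemma cinner_A_scaleC_scaleC:
  "cinner (A (c *\<^sub>C x)) (c *\<^sub>C x) = complex_of_real ((cmod c)\<^sup>2) * cinner (A x) x"
proof -
  have "cinner (A (c *\<^sub>C x)) (c *\<^sub>C x) = c * cnj c * cinner (A x) x"
    using cinner_commute[of "A x" "c *\<^sub>C x"] cinner_commute[of "A x" x]
    by (simp add: A_scaleC cinner_scaleC_left)
  thus ?thesis by (simp add: complex_norm_square flip: of_real_power)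
qed

lemma seminorm_scaleC: "\<parallel>c *\<^sub>C x\<parallel>\<^sub>A = cmod c * \<parallel>x\<parallel>\<^sub>A"
  by (simp add: semi_norm_def semi_inner_def cinner_A_scaleC_scaleC real_sqrt_mult)

lemma seminorm_scaleR: "\<parallel>r *\<^sub>R x\<parallel>\<^sub>A = \<bar>r\<bar> * \<parallel>x\<parallel>\<^sub>A"
  using seminorm_scaleC[of "complex_of_real r" x] by (simp add: scaleC_of_real)

lemma seminorm_minus: "\<parallel>- x\<parallel>\<^sub>A = \<parallel>x\<parallel>\<^sub>A"
  using seminorm_scaleR[of "-1" x] by simp

text \<open>
  Multiplying \<open>x\<close> by a number of modulus one makes the form real, which reduces the claim to the
  real Cauchy-Schwarz inequality.
\<close>

lemma cmod_semi_inner_le: "cmod (semi_inner A x y) \<le> \<parallel>x\<parallel>\<^sub>A * \<parallel>y\<parallel>\<^sub>A"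
proof (cases "semi_inner A x y = 0")
  case True
  then show ?thesis by (simp add: seminorm_nonneg)
next
  case False
  define z where "z = semi_inner A x y"
  define c where "c = cnj z / complex_of_real (cmod z)"
  have c1: "cmod c = 1" using False by (simp add: c_def z_def norm_divide)
  have "c * z = complex_of_real (cmod z)"
    using False complex_norm_square[of z]
    by (simp add: c_def z_def[symmetric] power2_eq_square divide_simps mult.commute)
  hence "cmod z = Re (cinner (A (c *\<^sub>C x)) y)"
    by (simp add: z_def semi_inner_def A_scaleC cinner_scaleC_left)
  also have "\<dots> \<le> \<parallel>c *\<^sub>C x\<parallel>\<^sub>A * \<parallel>y\<parallel>\<^sub>A"
    unfolding Re_cinner by (rule seminorm_cauchy_schwarz)
  finally show ?thesis by (simp add: z_def seminorm_scaleC c1)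
qed

lemma seminorm_triangle: "\<parallel>x + y\<parallel>\<^sub>A \<le> \<parallel>x\<parallel>\<^sub>A + \<parallel>y\<parallel>\<^sub>A"
proof (rule power2_le_imp_le)
  interpret A: bounded_linear A by (rule bounded_linear_A)
  have "inner (A y) x = inner (A x) y" by (metis inner_A_sym inner_commute)
  hence "\<parallel>x + y\<parallel>\<^sub>A\<^sup>2 = \<parallel>x\<parallel>\<^sub>A\<^sup>2 + \<parallel>y\<parallel>\<^sub>A\<^sup>2 + 2 * inner (A x) y"
    by (simp add: seminorm_squared A.add inner_add_left inner_add_right)
  thus "\<parallel>x + y\<parallel>\<^sub>A\<^sup>2 \<le> (\<parallel>x\<parallel>\<^sub>A + \<parallel>y\<parallel>\<^sub>A)\<^sup>2"
    using seminorm_cauchy_schwarz[of x y] by (simp add: power2_sum)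
qed (simp add: seminorm_nonneg)

lemma seminorm_eq_0_iff: "\<parallel>x\<parallel>\<^sub>A = 0 \<longleftrightarrow> A x = 0"
proof
  assume "\<parallel>x\<parallel>\<^sub>A = 0"
  hence "inner (A x) (A x) \<le> 0" using seminorm_cauchy_schwarz[of x "A x"] by simp
  thus "A x = 0" by (simp add: power2_norm_eq_inner[symmetric])
next
  assume "A x = 0"
  thus "\<parallel>x\<parallel>\<^sub>A = 0" by (simp add: semi_norm_def semi_inner_def Re_cinner)
qed

text \<open>
  The squared seminorm of \<open>T x\<close> is the value at \<open>x\<close> of the form of \<open>B = T' A T\<close>, where \<open>T'\<close> is the
  adjoint of \<open>T\<close>. The range of \<open>B\<close> lies in that of \<open>A\<close>, so \<open>B\<close> is dominated by a multiple of \<open>A\<close>,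
  first in norm and then as a form.
\<close>

lemma adjointable_bounded:
  assumes "T \<in> adjointable_ops A"
  obtains c where "\<And>x. \<parallel>T x\<parallel>\<^sub>A \<le> c * \<parallel>x\<parallel>\<^sub>A"
proof -
  have T: "bounded_clinear T" and range: "range (cadjoint T \<circ> A) \<subseteq> range A"
    using assms by (auto simp: adjointable_ops_def)
  define B where "B x = cadjoint T (A (T x))" for x
  have adj: "inner (T x) y = inner x (cadjoint T y)" for x y
    by (simp add: cinner_cadjoint[OF T] flip: Re_cinner)
  have B_form: "inner (B x) y = inner (A (T x)) (T y)" for x y
    using adj[of y "A (T x)"] by (simp add: B_def inner_commute)
  have B_sym: "inner (B x) y = inner x (B y)" for x y
    using B_form[of x y] adj[of x "A (T y)"] by (simp add: B_def inner_A_sym)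
  have "range B \<subseteq> range A" using range by (auto simp: B_def image_subset_iff)
  then obtain c where c: "0 \<le> c" "\<And>x. norm (B x) \<le> c * norm (A x)"
    using range_inclusion_imp_norm_bound[OF inner_A_sym B_sym] by blast
  have "\<parallel>T x\<parallel>\<^sub>A \<le> sqrt c * \<parallel>x\<parallel>\<^sub>A" for x
  proof (rule power2_le_imp_le)
    have "inner (B x) x \<le> c * inner (A x) x"
      by (rule norm_bound_imp_form_bound[OF bounded_linear_A inner_A_sym inner_A_nonneg B_sym c])
    thus "\<parallel>T x\<parallel>\<^sub>A\<^sup>2 \<le> (sqrt c * \<parallel>x\<parallel>\<^sub>A)\<^sup>2"
      using c(1) by (simp add: seminorm_squared power_mult_distrib B_form)
  qed (use c(1) in \<open>simp add: seminorm_nonneg\<close>)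
  with that show ?thesis by blast
qed

text \<open>
  Here \<open>v\<close> is the orthogonal projection of \<open>x\<close>; symmetry of \<open>A\<close> makes the orthogonal complement of
  its range its kernel.
\<close>

lemma decompose_closure_range_kernel:
  obtains v where "v \<in> closure (range A)" "A (x - v) = 0"
proof -
  interpret A: bounded_linear A by (rule bounded_linear_A)
  have "subspace (closure (range A))"
    by (intro subspace_closure linear_subspace_image A.linear_axioms subspace_UNIV)
  then obtain v where v: "v \<in> closure (range A)"
    and orth: "\<And>u. u \<in> closure (range A) \<Longrightarrow> inner x u = inner v u"
    using riesz_on_closed_subspace[OF _ closed_closure bounded_linear_inner_right] by blast
  have "A (A (x - v)) \<in> closure (range A)" by (meson closure_subset rangeI subsetD)
  hence "inner (x - v) (A (A (x - v))) = 0" using orth by (simp add: inner_diff_left)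
  hence "inner (A (x - v)) (A (x - v)) = 0" by (simp add: inner_A_sym)
  with v that show ?thesis by simp
qed

section \<open>Operator seminorm and numerical radius as best constants\<close>

lemma op_seminorm_le:
  assumes "A \<noteq> (\<lambda>_. 0)" and c: "0 \<le> c" "\<And>x. \<parallel>S x\<parallel>\<^sub>A \<le> c * \<parallel>x\<parallel>\<^sub>A"
  shows "op_seminorm A S \<le> c"
  unfolding op_seminorm_def
proof (rule cSUP_least)
  from assms(1) obtain x where "A x \<noteq> 0" by blast
  moreover have "A x \<in> closure (range A)" by (meson closure_subset rangeI subsetD)
  ultimately show "{x \<in> closure (range A). x \<noteq> 0} \<noteq> {}" by blast
  show "\<parallel>S x\<parallel>\<^sub>A / \<parallel>x\<parallel>\<^sub>A \<le> c" for x
    using c(1) c(2)[of x] seminorm_nonneg[of x] by (cases "\<parallel>x\<parallel>\<^sub>A = 0") (auto simp: divide_simps)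
qed

text \<open>
  Boundedness by some \<open>c\<close> makes the supremum finite. It also makes \<open>S\<close> preserve seminorm zero, so \<open>x\<close>
  may be replaced by its projection to the closure of the range of \<open>A\<close>, over which the
  supremum extends.
\<close>

lemma seminorm_le_op_seminorm:
  assumes S: "linear S" and c: "\<And>x. \<parallel>S x\<parallel>\<^sub>A \<le> c * \<parallel>x\<parallel>\<^sub>A"
  shows "\<parallel>S x\<parallel>\<^sub>A \<le> op_seminorm A S * \<parallel>x\<parallel>\<^sub>A"
proof -
  have kernel: "\<parallel>S z\<parallel>\<^sub>A = 0" if "\<parallel>z\<parallel>\<^sub>A = 0" for z
    using c[of z] that seminorm_nonneg[of "S z"] by simp
  obtain v where v: "v \<in> closure (range A)" "A (x - v) = 0"
    by (rule decompose_closure_range_kernel)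
  have xv: "\<parallel>x - v\<parallel>\<^sub>A = 0" using v(2) by (simp add: seminorm_eq_0_iff)
  have Sx: "\<parallel>S x\<parallel>\<^sub>A \<le> \<parallel>S v\<parallel>\<^sub>A"
    using seminorm_triangle[of "S v" "S (x - v)"] kernel[OF xv] by (simp add: linear_diff[OF S])
  have vx: "\<parallel>v\<parallel>\<^sub>A = \<parallel>x\<parallel>\<^sub>A"
    using seminorm_triangle[of v "x - v"] seminorm_triangle[of x "- (x - v)"] xv
    by (simp only: seminorm_minus) simp
  show ?thesis
  proof (cases "\<parallel>v\<parallel>\<^sub>A = 0")
    case True
    then show ?thesis using vx kernel by simp
  next
    case False
    hence v0: "0 < \<parallel>v\<parallel>\<^sub>A" using seminorm_nonneg[of v] by simp
    have ratio: "\<parallel>S z\<parallel>\<^sub>A / \<parallel>z\<parallel>\<^sub>A \<le> c" if "0 < \<parallel>z\<parallel>\<^sub>A" for z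
      using c[of z] that by (simp add: divide_simps)
    have "\<parallel>S z\<parallel>\<^sub>A / \<parallel>z\<parallel>\<^sub>A \<le> max c 0" for z
      using ratio[of z] seminorm_nonneg[of z] by (cases "\<parallel>z\<parallel>\<^sub>A = 0") auto
    hence bdd: "bdd_above ((\<lambda>z. \<parallel>S z\<parallel>\<^sub>A / \<parallel>z\<parallel>\<^sub>A) ` {z \<in> closure (range A). z \<noteq> 0})"
      by (rule bdd_aboveI2)
    have "v \<noteq> 0" using False seminorm_scaleR[of 0 0] by auto
    hence "\<parallel>S v\<parallel>\<^sub>A / \<parallel>v\<parallel>\<^sub>A \<le> op_seminorm A S"
      unfolding op_seminorm_def using v(1) by (intro cSUP_upper[OF _ bdd]) simp
    thus ?thesis using v0 Sx vx by (simp add: field_simps)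
  qed
qed

lemma op_seminorm_nonneg:
  assumes A: "A \<noteq> (\<lambda>_. 0)" and S: "linear S" and c: "\<And>x. \<parallel>S x\<parallel>\<^sub>A \<le> c * \<parallel>x\<parallel>\<^sub>A"
  shows "0 \<le> op_seminorm A S"
proof -
  obtain x where "A x \<noteq> 0" using A by blast
  hence "0 < \<parallel>x\<parallel>\<^sub>A" using seminorm_eq_0_iff[of x] seminorm_nonneg[of x] by simp
  moreover have "0 \<le> op_seminorm A S * \<parallel>x\<parallel>\<^sub>A"
    using seminorm_le_op_seminorm[OF S c, of x] seminorm_nonneg[of "S x"] by linarith
  ultimately show ?thesis by (simp add: zero_le_mult_iff)
qed

lemma num_radius_le:
  assumes A: "A \<noteq> (\<lambda>_. 0)" and c: "\<And>x. cmod (semi_inner A (S x) x) \<le> c * \<parallel>x\<parallel>\<^sub>A\<^sup>2"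
  shows "num_radius A S \<le> c"
  unfolding num_radius_def
proof (rule cSUP_least)
  from A obtain x where "A x \<noteq> 0" by blast
  hence "\<parallel>x\<parallel>\<^sub>A \<noteq> 0" by (simp add: seminorm_eq_0_iff)
  hence "\<parallel>(1 / \<parallel>x\<parallel>\<^sub>A) *\<^sub>R x\<parallel>\<^sub>A = 1" using seminorm_nonneg[of x] by (simp add: seminorm_scaleR)
  thus "{x. \<parallel>x\<parallel>\<^sub>A = 1} \<noteq> {}" by blast
  show "cmod (semi_inner A (S x) x) \<le> c" if "x \<in> {x. \<parallel>x\<parallel>\<^sub>A = 1}" for x
    using c[of x] that by simp
qed

lemma cmod_semi_inner_le_num_radius:
  assumes S: "linear S" and c: "\<And>x. cmod (semi_inner A (S x) x) \<le> c * \<parallel>x\<parallel>\<^sub>A\<^sup>2"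
  shows "cmod (semi_inner A (S x) x) \<le> num_radius A S * \<parallel>x\<parallel>\<^sub>A\<^sup>2"
proof (cases "\<parallel>x\<parallel>\<^sub>A = 0")
  case True
  then show ?thesis using c[of x] by simp
next
  case False
  hence x0: "0 < \<parallel>x\<parallel>\<^sub>A" using seminorm_nonneg[of x] by simp
  define r where "r = 1 / \<parallel>x\<parallel>\<^sub>A"
  have "cmod (semi_inner A (S z) z) \<le> c" if "z \<in> {z. \<parallel>z\<parallel>\<^sub>A = 1}" for z
    using c[of z] that by simp
  hence bdd: "bdd_above ((\<lambda>z. cmod (semi_inner A (S z) z)) ` {z. \<parallel>z\<parallel>\<^sub>A = 1})"
    by (rule bdd_aboveI2)
  have "\<parallel>r *\<^sub>R x\<parallel>\<^sub>A = 1" using x0 by (simp add: r_def seminorm_scaleR)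
  hence "cmod (semi_inner A (S (r *\<^sub>R x)) (r *\<^sub>R x)) \<le> num_radius A S"
    unfolding num_radius_def by (intro cSUP_upper[OF _ bdd]) simp
  moreover have "semi_inner A (S (r *\<^sub>R x)) (r *\<^sub>R x) = complex_of_real (r\<^sup>2) * semi_inner A (S x) x"
  proof -
    have *: "cinner u (complex_of_real r *\<^sub>C w) = complex_of_real r * cinner u w" for u w :: 'a
      using cinner_commute[of u "complex_of_real r *\<^sub>C w"] cinner_commute[of u w]
      by (simp add: cinner_scaleC_left)
    have "S (r *\<^sub>R x) = complex_of_real r *\<^sub>C S x"
      by (simp add: scaleC_of_real linear_cmul[OF S])
    moreover have "r *\<^sub>R x = complex_of_real r *\<^sub>C x" by (simp add: scaleC_of_real)
    ultimately show ?thesis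
      by (simp add: semi_inner_def A_scaleC cinner_scaleC_left * power2_eq_square)
  qed
  ultimately have "r\<^sup>2 * cmod (semi_inner A (S x) x) \<le> num_radius A S"
    by (simp add: norm_mult norm_power)
  thus ?thesis using x0 by (simp add: r_def field_simps)
qed

end

section \<open>The diagonal operator on the direct sum\<close>

context semi_hilbert
begin

lemma diag_op_apply: "diag_op A (x, y) = (A x, A y)"
  by (simp add: diag_op_def block_op_def)

lemma semi_hilbert_diag_op: "semi_hilbert (diag_op A)"
proof
  have eq: "diag_op A = (\<lambda>p. (A (fst p), A (snd p)))" by (auto simp: diag_op_apply)
  have "bounded_linear (diag_op A)"
    unfolding eq by (intro bounded_linear_Pair bounded_linear_compose[OF bounded_linear_A]
        bounded_linear_fst bounded_linear_snd)
  moreover have "cadjoint (diag_op A) = diag_op A"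
    by (rule cadjoint_eqI) (simp add: eq cinner_prod_def cinner_A_sym)
  moreover have "cinner (diag_op A p) p \<in> \<real>\<^sub>\<ge>\<^sub>0" for p
    using positive by (auto simp: eq cinner_prod_def positive_op_def intro: nonneg_Reals_add_I)
  ultimately show "positive_op (diag_op A)"
    by (simp add: positive_op_def bounded_clinear_def eq scaleC_prod_def A_scaleC)
qed

lemma diag_op_nonzero: "A \<noteq> (\<lambda>_. 0) \<Longrightarrow> diag_op A \<noteq> (\<lambda>_. 0)"
  by (auto simp: fun_eq_iff diag_op_apply zero_prod_def)

lemma diag_seminorm_squared:
  "(semi_norm (diag_op A) (x, y))\<^sup>2 = \<parallel>x\<parallel>\<^sub>A\<^sup>2 + \<parallel>y\<parallel>\<^sub>A\<^sup>2"
  by (simp add: semi_hilbert.seminorm_squared[OF semi_hilbert_diag_op] seminorm_squared diag_op_apply)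

end

section \<open>Scalar inequalities\<close>

text \<open>
  The number \<open>n\<close> is the norm of the \<open>2 \<times> 2\<close> matrix with rows \<open>1, t\<close> and \<open>0, -1\<close>: the difference
  of the two sides is a square up to a nonnegative factor.
\<close>

lemma block_norm_upper_bound:
  fixes a b t n :: real
  assumes n: "1 \<le> n" and t: "0 \<le> t" "n - 1 / n = t"
  shows "(a + t * b)\<^sup>2 + b\<^sup>2 \<le> n\<^sup>2 * (a\<^sup>2 + b\<^sup>2)"
proof -
  have t': "t * n = n\<^sup>2 - 1" using n by (simp add: t(2)[symmetric] field_simps power2_eq_square)
  have "n * (n\<^sup>2 * (a\<^sup>2 + b\<^sup>2) - (a + t * b)\<^sup>2 - b\<^sup>2) = t * (n * a - b)\<^sup>2"
    using t' by algebra
  also have "0 \<le> \<dots>" using t by simp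
  finally show ?thesis using n by (simp add: zero_le_mult_iff)
qed

text \<open>
  The hypothesis is a quadratic inequality in \<open>l\<close>, which is sharpest at its vertex
  \<open>l = 1 / (n\<^sup>2 - 1)\<close>. If \<open>n = 1\<close> there is no vertex, and \<open>l = 0\<close> already gives \<open>s = 0\<close>.
\<close>

lemma block_norm_lower_bound:
  fixes n s b :: real
  assumes n: "1 \<le> n" and b: "0 \<le> b"
    and le: "\<And>l. (l + 1)\<^sup>2 * s\<^sup>2 + b\<^sup>2 \<le> n\<^sup>2 * (l\<^sup>2 * s\<^sup>2 + b\<^sup>2)"
  shows "s \<le> (n - 1 / n) * b"
proof (cases "n = 1")
  case True
  with le[of 0] show ?thesis by simp
next
  case False
  define k where "k = n\<^sup>2 - 1"
  have k: "0 < k" using n False by (simp add: k_def)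
  have kl: "k * (1 / k) = 1" using k by simp
  have "(1 / k + 1)\<^sup>2 * s\<^sup>2 + b\<^sup>2 \<le> (k + 1) * ((1 / k)\<^sup>2 * s\<^sup>2 + b\<^sup>2)"
    using le[of "1 / k"] by (simp add: k_def)
  hence "k\<^sup>2 * ((1 / k + 1)\<^sup>2 * s\<^sup>2 + b\<^sup>2) \<le> k\<^sup>2 * ((k + 1) * ((1 / k)\<^sup>2 * s\<^sup>2 + b\<^sup>2))"
    by (rule mult_left_mono) simp
  also have "k\<^sup>2 * ((k + 1) * ((1 / k)\<^sup>2 * s\<^sup>2 + b\<^sup>2)) = (k + 1) * (s\<^sup>2 + k\<^sup>2 * b\<^sup>2)"
    using kl by algebra
  also have "k\<^sup>2 * ((1 / k + 1)\<^sup>2 * s\<^sup>2 + b\<^sup>2) = (k + 1)\<^sup>2 * s\<^sup>2 + k\<^sup>2 * b\<^sup>2"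
    using kl by algebra
  finally have "k * (n * s)\<^sup>2 \<le> k * (k * b)\<^sup>2"
    unfolding k_def by (simp add: algebra_simps power2_eq_square)
  hence "(n * s)\<^sup>2 \<le> (k * b)\<^sup>2" using k by simp
  hence "n * s \<le> k * b" by (rule power2_le_imp_le) (use b k in simp)
  hence "s \<le> k * b / n" using n by (simp add: field_simps)
  also have "k * b / n = (n - 1 / n) * b" using n by (simp add: k_def field_simps power2_eq_square)
  finally show ?thesis .
qed

text \<open>
  Cauchy-Schwarz in the plane for \<open>(1, t / 2)\<close> and \<open>(\<bar>a\<^sup>2 - b\<^sup>2\<bar>, 2 * a * b)\<close>; the latter vector has
  length \<open>a\<^sup>2 + b\<^sup>2\<close>.
\<close>

lemma block_radius_upper_bound:
  fixes a b t :: real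
  shows "\<bar>a\<^sup>2 - b\<^sup>2\<bar> + t * b * a \<le> sqrt (1 + t\<^sup>2 / 4) * (a\<^sup>2 + b\<^sup>2)"
proof (rule power2_le_imp_le)
  define d where "d = \<bar>a\<^sup>2 - b\<^sup>2\<bar>"
  have d: "d\<^sup>2 = (a\<^sup>2 - b\<^sup>2)\<^sup>2" by (simp add: d_def)
  have "(1 + t\<^sup>2 / 4) * (a\<^sup>2 + b\<^sup>2)\<^sup>2 - (d + t * b * a)\<^sup>2 = (t / 2 * d - 2 * a * b)\<^sup>2"
    using d by (simp add: field_simps) algebra
  hence "(d + t * b * a)\<^sup>2 \<le> (1 + t\<^sup>2 / 4) * (a\<^sup>2 + b\<^sup>2)\<^sup>2"
    by (metis diff_ge_0_iff_ge zero_le_power2)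
  thus "(\<bar>a\<^sup>2 - b\<^sup>2\<bar> + t * b * a)\<^sup>2 \<le> (sqrt (1 + t\<^sup>2 / 4) * (a\<^sup>2 + b\<^sup>2))\<^sup>2"
    by (simp add: d_def power_mult_distrib)
qed simp

text \<open>
  Again a quadratic inequality in \<open>l\<close>, with vertex \<open>l = 1 / (2 * (w - 1))\<close>. For \<open>w = 1\<close> it is linear,
  and large \<open>l\<close> force \<open>s = 0\<close>.
\<close>

lemma block_radius_lower_bound:
  fixes w s b :: real
  assumes w: "1 \<le> w"
    and le: "\<And>l. (l + 1) * l * s\<^sup>2 - b\<^sup>2 \<le> w * (l\<^sup>2 * s\<^sup>2 + b\<^sup>2)"
  shows "s\<^sup>2 \<le> 4 * (w\<^sup>2 - 1) * b\<^sup>2"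
proof (cases "w = 1")
  case True
  have "l * s\<^sup>2 \<le> 2 * b\<^sup>2" for l
    using le[of l] True by (simp add: algebra_simps power2_eq_square)
  from this[of "(2 * b\<^sup>2 + 1) / s\<^sup>2"] have "s = 0" by (cases "s = 0") auto
  thus ?thesis using w by simp
next
  case False
  define k where "k = w - 1"
  have k: "0 < k" using w False by (simp add: k_def)
  define l where "l = 1 / (2 * k)"
  have kl: "2 * k * l = 1" using k by (simp add: l_def)
  have "(l + 1) * l * s\<^sup>2 - b\<^sup>2 \<le> (k + 1) * (l\<^sup>2 * s\<^sup>2 + b\<^sup>2)"
    using le[of l] by (simp add: k_def)
  hence "4 * k * ((l + 1) * l * s\<^sup>2 - b\<^sup>2) \<le> 4 * k * ((k + 1) * (l\<^sup>2 * s\<^sup>2 + b\<^sup>2))"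
    using k by (intro mult_left_mono) auto
  moreover have "4 * k * ((l + 1) * l * s\<^sup>2 - b\<^sup>2) = 2 * (l + 1) * s\<^sup>2 - 4 * k * b\<^sup>2"
    using kl by algebra
  moreover have "4 * k * ((k + 1) * (l\<^sup>2 * s\<^sup>2 + b\<^sup>2)) = (1 + 2 * l) * s\<^sup>2 + 4 * k * (k + 1) * b\<^sup>2"
    using kl by algebra
  ultimately show ?thesis by (simp add: k_def algebra_simps power2_eq_square)
qed

section \<open>Seminorm and numerical radius of the block operator\<close>

context semi_hilbert
begin

abbreviation "block T \<equiv> block_op (\<lambda>x. x) T (\<lambda>_. 0) (\<lambda>x. - x)"

lemma block_apply: "block T (x, y) = (x + T y, - y)"
  by (simp add: block_op_def)

lemma linear_block:
  assumes "linear T"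
  shows "linear (block T)"
  using assms by (auto intro!: linearI simp: block_apply linear_add linear_cmul algebra_simps)

text \<open>
  As \<open>n - 1 / n\<close> increases with \<open>n\<close>, a bound for the seminorm of the block operator and one for that
  of \<open>T\<close> suffice; the second comes from the test vectors \<open>(l *\<^sub>R T y, y)\<close>.
\<close>

lemma op_seminorm_block:
  assumes A: "A \<noteq> (\<lambda>_. 0)" and T: "linear T" and T_le: "\<And>x. \<parallel>T x\<parallel>\<^sub>A \<le> c * \<parallel>x\<parallel>\<^sub>A"
  defines "n \<equiv> op_seminorm (diag_op A) (block T)"
  shows "1 \<le> n" and "n - 1 / n = op_seminorm A T"
proof -
  interpret diag: semi_hilbert "diag_op A" by (rule semi_hilbert_diag_op)
  define t where "t = op_seminorm A T"
  have t0: "0 \<le> t" unfolding t_def by (rule op_seminorm_nonneg[OF A T T_le])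
  have T_le': "\<parallel>T y\<parallel>\<^sub>A \<le> t * \<parallel>y\<parallel>\<^sub>A" for y
    unfolding t_def by (rule seminorm_le_op_seminorm[OF T T_le])
  \<comment> \<open>\<open>N\<close> is the positive root of \<open>N - 1 / N = t\<close>, the value that \<open>n\<close> turns out to have.\<close>
  define r where "r = sqrt (t\<^sup>2 + 4)"
  define N where "N = (t + r) / 2"
  have r: "r\<^sup>2 = t\<^sup>2 + 4" "2 \<le> r"
    by (auto simp: r_def real_le_rsqrt)
  have N1: "1 \<le> N" using t0 r(2) by (simp add: N_def)
  have "N * N - 1 = t * N" using r(1) by (simp add: N_def field_simps power2_eq_square)
  hence N: "N - 1 / N = t" using N1 by (simp add: field_simps)
  have bound: "semi_norm (diag_op A) (block T p) \<le> N * semi_norm (diag_op A) p" for p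
  proof (cases p)
    case (Pair x y)
    have "\<parallel>x + T y\<parallel>\<^sub>A \<le> \<parallel>x\<parallel>\<^sub>A + t * \<parallel>y\<parallel>\<^sub>A"
      using seminorm_triangle[of x "T y"] T_le'[of y] by simp
    hence "\<parallel>x + T y\<parallel>\<^sub>A\<^sup>2 + \<parallel>y\<parallel>\<^sub>A\<^sup>2 \<le> (\<parallel>x\<parallel>\<^sub>A + t * \<parallel>y\<parallel>\<^sub>A)\<^sup>2 + \<parallel>y\<parallel>\<^sub>A\<^sup>2"
      by (simp add: power_mono seminorm_nonneg)
    also have "\<dots> \<le> N\<^sup>2 * (\<parallel>x\<parallel>\<^sub>A\<^sup>2 + \<parallel>y\<parallel>\<^sub>A\<^sup>2)"
      by (rule block_norm_upper_bound[OF N1 t0 N])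
    finally have "(semi_norm (diag_op A) (block T p))\<^sup>2 \<le> (N * semi_norm (diag_op A) p)\<^sup>2"
      by (simp add: Pair block_apply diag_seminorm_squared power_mult_distrib seminorm_minus)
    thus ?thesis by (rule power2_le_imp_le) (use N1 in \<open>simp add: diag.seminorm_nonneg\<close>)
  qed
  have nN: "n \<le> N"
    unfolding n_def using N1 by (intro diag.op_seminorm_le diag_op_nonzero A bound) auto
  have n_le: "semi_norm (diag_op A) (block T p) \<le> n * semi_norm (diag_op A) p" for p
    unfolding n_def by (rule diag.seminorm_le_op_seminorm[OF linear_block[OF T] bound])
  show n1: "1 \<le> n"
  proof -
    obtain x where "A x \<noteq> 0" using A by blast
    hence "0 < semi_norm (diag_op A) (x, 0)"
      using diag.seminorm_nonneg[of "(x, 0)"] diag.seminorm_eq_0_iff[of "(x, 0)"]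
      by (simp add: diag_op_apply zero_prod_def less_le)
    thus ?thesis using n_le[of "(x, 0)"] by (simp add: block_apply linear_0[OF T])
  qed
  have n_le_sq: "\<parallel>x + T y\<parallel>\<^sub>A\<^sup>2 + \<parallel>y\<parallel>\<^sub>A\<^sup>2 \<le> n\<^sup>2 * (\<parallel>x\<parallel>\<^sub>A\<^sup>2 + \<parallel>y\<parallel>\<^sub>A\<^sup>2)" for x y
    using power_mono[OF n_le[of "(x, y)"] diag.seminorm_nonneg, of 2]
    by (simp add: block_apply diag_seminorm_squared power_mult_distrib seminorm_minus)
  have "\<parallel>T y\<parallel>\<^sub>A \<le> (n - 1 / n) * \<parallel>y\<parallel>\<^sub>A" for y
  proof (rule block_norm_lower_bound[OF n1 seminorm_nonneg])
    fix l :: real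
    have "l *\<^sub>R T y + T y = (l + 1) *\<^sub>R T y" by (simp add: scaleR_left_distrib)
    thus "(l + 1)\<^sup>2 * \<parallel>T y\<parallel>\<^sub>A\<^sup>2 + \<parallel>y\<parallel>\<^sub>A\<^sup>2 \<le> n\<^sup>2 * (l\<^sup>2 * \<parallel>T y\<parallel>\<^sub>A\<^sup>2 + \<parallel>y\<parallel>\<^sub>A\<^sup>2)"
      using n_le_sq[of "l *\<^sub>R T y" y] by (simp add: seminorm_scaleR power_mult_distrib)
  qed
  moreover have "1 / n \<le> n" using n1 mult_mono[of 1 n 1 n] by (simp add: divide_simps)
  ultimately have "t \<le> n - 1 / n" unfolding t_def by (intro op_seminorm_le A) auto
  moreover have "n - 1 / n \<le> N - 1 / N"
    using nN n1 by (intro diff_mono divide_left_mono) auto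
  ultimately show "n - 1 / n = op_seminorm A T" using N by (simp add: t_def)
qed

text \<open>
  At \<open>(x, y)\<close> the form of the block operator is the difference of the squared seminorms of \<open>x\<close> and \<open>y\<close>
  plus \<open>semi_inner A (T y) x\<close>. At \<open>(l *\<^sub>R T y, y)\<close> all these terms are real, so taking real parts
  loses nothing on the vectors that give the lower bound.
\<close>

lemma num_radius_block:
  assumes A: "A \<noteq> (\<lambda>_. 0)" and T: "linear T" and T_le: "\<And>x. \<parallel>T x\<parallel>\<^sub>A \<le> c * \<parallel>x\<parallel>\<^sub>A"
  shows "2 * num_radius (diag_op A) (block T) = sqrt ((op_seminorm A T)\<^sup>2 + 4)"
proof -
  interpret diag: semi_hilbert "diag_op A" by (rule semi_hilbert_diag_op)
  define w where "w = num_radius (diag_op A) (block T)"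
  define t where "t = op_seminorm A T"
  have t0: "0 \<le> t" unfolding t_def by (rule op_seminorm_nonneg[OF A T T_le])
  have T_le': "\<parallel>T y\<parallel>\<^sub>A \<le> t * \<parallel>y\<parallel>\<^sub>A" for y
    unfolding t_def by (rule seminorm_le_op_seminorm[OF T T_le])
  define W where "W = sqrt (1 + t\<^sup>2 / 4)"
  have form: "semi_inner (diag_op A) (block T (x, y)) (x, y)
      = complex_of_real (\<parallel>x\<parallel>\<^sub>A\<^sup>2 - \<parallel>y\<parallel>\<^sub>A\<^sup>2) + semi_inner A (T y) x" for x y
  proof -
    interpret A: bounded_linear A by (rule bounded_linear_A)
    have "cinner (A (- y)) y = - cinner (A y) y"
      using cinner_scaleC_left[of "-1" "A y" y] scaleC_of_real[of "-1" "A y"] by (simp add: A.neg)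
    moreover have "cinner (A x) x = complex_of_real (\<parallel>x\<parallel>\<^sub>A\<^sup>2)" for x
      using semi_inner_self[of x] by (simp add: semi_inner_def)
    ultimately show ?thesis
      by (simp add: semi_inner_def block_apply diag_op_apply cinner_prod_def A.add cinner_add_left)
  qed
  have bound: "cmod (semi_inner (diag_op A) (block T p) p) \<le> W * (semi_norm (diag_op A) p)\<^sup>2" for p
  proof (cases p)
    case (Pair x y)
    have "cmod (semi_inner (diag_op A) (block T p) p)
        \<le> \<bar>\<parallel>x\<parallel>\<^sub>A\<^sup>2 - \<parallel>y\<parallel>\<^sub>A\<^sup>2\<bar> + cmod (semi_inner A (T y) x)"
      unfolding Pair form by (rule order_trans[OF norm_triangle_ineq]) (simp del: of_real_diff)
    also have "cmod (semi_inner A (T y) x) \<le> t * \<parallel>y\<parallel>\<^sub>A * \<parallel>x\<parallel>\<^sub>A"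
      using cmod_semi_inner_le[of "T y" x] mult_right_mono[OF T_le'[of y] seminorm_nonneg[of x]]
      by linarith
    also have "\<bar>\<parallel>x\<parallel>\<^sub>A\<^sup>2 - \<parallel>y\<parallel>\<^sub>A\<^sup>2\<bar> + t * \<parallel>y\<parallel>\<^sub>A * \<parallel>x\<parallel>\<^sub>A \<le> W * (\<parallel>x\<parallel>\<^sub>A\<^sup>2 + \<parallel>y\<parallel>\<^sub>A\<^sup>2)"
      unfolding W_def by (rule block_radius_upper_bound)
    finally show ?thesis by (simp add: Pair diag_seminorm_squared)
  qed
  have wW: "w \<le> W"
    unfolding w_def by (intro diag.num_radius_le diag_op_nonzero A bound)
  have w_ge: "\<parallel>x\<parallel>\<^sub>A\<^sup>2 - \<parallel>y\<parallel>\<^sub>A\<^sup>2 + inner (A (T y)) x \<le> w * (\<parallel>x\<parallel>\<^sub>A\<^sup>2 + \<parallel>y\<parallel>\<^sub>A\<^sup>2)" for x y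
  proof -
    have "Re (semi_inner (diag_op A) (block T (x, y)) (x, y))
        \<le> w * (semi_norm (diag_op A) (x, y))\<^sup>2"
      unfolding w_def
      by (rule order_trans[OF complex_Re_le_cmod
            diag.cmod_semi_inner_le_num_radius[OF linear_block[OF T] bound]])
    thus ?thesis unfolding form diag_seminorm_squared by (simp add: semi_inner_def Re_cinner)
  qed
  have w1: "1 \<le> w"
  proof -
    interpret A: bounded_linear A by (rule bounded_linear_A)
    obtain x where "A x \<noteq> 0" using A by blast
    hence "0 < \<parallel>x\<parallel>\<^sub>A\<^sup>2" using seminorm_eq_0_iff[of x] by simp
    moreover have "\<parallel>0\<parallel>\<^sub>A = 0" by (simp add: seminorm_eq_0_iff A.zero)
    ultimately show ?thesis using w_ge[of x 0] by (simp add: linear_0[OF T] A.zero)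
  qed
  have "\<parallel>T y\<parallel>\<^sub>A \<le> sqrt (4 * (w\<^sup>2 - 1)) * \<parallel>y\<parallel>\<^sub>A" for y
  proof (rule power2_le_imp_le)
    have "\<parallel>T y\<parallel>\<^sub>A\<^sup>2 \<le> 4 * (w\<^sup>2 - 1) * \<parallel>y\<parallel>\<^sub>A\<^sup>2"
    proof (rule block_radius_lower_bound[OF w1])
      fix l :: real
      show "(l + 1) * l * \<parallel>T y\<parallel>\<^sub>A\<^sup>2 - \<parallel>y\<parallel>\<^sub>A\<^sup>2 \<le> w * (l\<^sup>2 * \<parallel>T y\<parallel>\<^sub>A\<^sup>2 + \<parallel>y\<parallel>\<^sub>A\<^sup>2)"
        using w_ge[of "l *\<^sub>R T y" y]
        by (simp add: seminorm_scaleR power_mult_distrib flip: seminorm_squared)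
          (simp add: algebra_simps power2_eq_square)
    qed
    thus "\<parallel>T y\<parallel>\<^sub>A\<^sup>2 \<le> (sqrt (4 * (w\<^sup>2 - 1)) * \<parallel>y\<parallel>\<^sub>A)\<^sup>2"
      using w1 by (simp add: power_mult_distrib)
  qed (use w1 in \<open>simp add: seminorm_nonneg\<close>)
  hence "t \<le> sqrt (4 * (w\<^sup>2 - 1))"
    unfolding t_def using w1 by (intro op_seminorm_le A) auto
  hence "t\<^sup>2 \<le> (sqrt (4 * (w\<^sup>2 - 1)))\<^sup>2" using t0 by (rule power_mono)
  hence "1 + t\<^sup>2 / 4 \<le> w\<^sup>2" using w1 by simp
  hence "W \<le> w" unfolding W_def using w1 by (intro real_le_lsqrt) auto
  hence "2 * w = 2 * W" using wW by simp
  also have "\<dots> = sqrt (2\<^sup>2 * (1 + t\<^sup>2 / 4))" unfolding W_def by (simp only: real_sqrt_mult real_sqrt_abs)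
  finally show ?thesis by (simp add: w_def t_def add.commute)
qed

end

theorem corollary3p3:
  fixes A T :: "'a::complex_hilbert \<Rightarrow> 'a"
  assumes "positive_op A"
    and "A \<noteq> (\<lambda>_. 0)"
    and "T \<in> adjointable_ops A"
  shows "2 * num_radius (diag_op A) (block_op (\<lambda>x. x) T (\<lambda>_. 0) (\<lambda>x. - x)) =
    op_seminorm (diag_op A) (block_op (\<lambda>x. x) T (\<lambda>_. 0) (\<lambda>x. - x)) +
    inverse (op_seminorm (diag_op A) (block_op (\<lambda>x. x) T (\<lambda>_. 0) (\<lambda>x. - x)))"
proof -
  interpret semi_hilbert A by unfold_locales (rule assms(1))
  have T: "linear T"
    using assms(3) by (simp add: adjointable_ops_def bounded_clinear_def bounded_linear.linear)
  obtain c where c: "\<And>x. semi_norm A (T x) \<le> c * semi_norm A x"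
    using adjointable_bounded[OF assms(3)] by blast
  define n where "n = op_seminorm (diag_op A) (block T)"
  have n1: "1 \<le> n" and t: "n - 1 / n = op_seminorm A T"
    using op_seminorm_block[OF assms(2) T c] by (simp_all add: n_def)
  have "(op_seminorm A T)\<^sup>2 + 4 = (n + inverse n)\<^sup>2"
    unfolding t[symmetric] using n1 by (simp add: field_simps power2_eq_square)
  hence "2 * num_radius (diag_op A) (block T) = n + inverse n"
    using num_radius_block[OF assms(2) T c] n1 by simp
  thus ?thesis by (simp add: n_def)
qed

end
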